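(* For every integer $n\ge 3$, \[\gcd(n^n, a_n(n)) = \begin{cases} 2^{1+\nu_2(\lfloor n/12\rfloor)}\,n^2 & \text{if } n \equiv 2 \pmod{12},\\ n^2 & \text{if } n \equiv 5,8,11 \pmod{12},\\ 1 & \text{otherwise.}\end{cases}\]
   Context: The polynomials $a_i(x)$ are defined by $a_1(x)=x-1$, $a_2(x)=x(x-2)$, and $a_{i+2}(x)=(2x-1)a_{i+1}(x)-(x^2-x+1)a_i(x)$ for $i\ge 1$; $a_n(n)$ is the value of $a_n(x)$ at $x=n$. $\nu_2(m)$ denotes the exponent of the highest power of $2$ dividing the integer $m$. *)

theory Defs
  imports
    "HOL-Computational_Algebra.Polynomial"
    "HOL-Computational_Algebra.Factorial_Ring"
    "HOL-Number_Theory.Cong"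
begin

(* The sequence starts at index 1.  Index 0 is outside its range and never used;
   the value 1 given there is the one obtained by running the recurrence backwards. *)
fun a_poly :: "nat \<Rightarrow> int poly" where
  "a_poly 0 = 1"
| "a_poly (Suc 0) = [:-1, 1:]"
| "a_poly (Suc (Suc 0)) = [:0, 1:] * [:-2, 1:]"
| "a_poly (Suc (Suc (Suc i))) =
     [:-1, 2:] * a_poly (Suc (Suc i)) - [:1, -1, 1:] * a_poly (Suc i)"

(* The 2-adic valuation of a positive m (the library sets multiplicity 2 0 = 0). *)
abbreviation nu2 :: "nat \<Rightarrow> nat" where
  "nu2 m \<equiv> multiplicity 2 m"

end

theory Submission
  imports Defs
begin

text \<open>
  Let \<open>\<omega>\<close> be a primitive cube root of unity.  The characteristic polynomial
  \<open>t\<^sup>2 - (2 x - 1) t + (x\<^sup>2 - x + 1)\<close> of the recurrence has the roots \<open>x + \<omega>\<close> and \<open>x + \<omega>\<^sup>2\<close>,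
  so expanding \<open>(x + \<omega>)^n\<close> and \<open>(x + \<omega>\<^sup>2)^n\<close> binomially writes \<open>a\<^sub>n(x)\<close> as the sum of
  \<open>(n choose j) x^j s(n - j)\<close>, where \<open>s\<close> runs periodically through \<open>1, -1, 0\<close>
  (\<open>poly_a_poly_eq_binomial_sum\<close>).

  At \<open>x = n\<close> the term \<open>j = 0\<close> is \<open>s(n)\<close> and all the others are multiples of \<open>n\<close>.  Hence the gcd
  is \<open>1\<close> unless \<open>n \<equiv> 2 (mod 3)\<close>.  In that case the terms \<open>j = 0\<close> and \<open>j = 3\<close> vanish, and
  \<open>a\<^sub>n(n) = n\<^sup>2 b\<close> with \<open>b = (n choose 2) - 1 + n t\<close> (\<open>poly_a_poly_self_factor\<close>).
  Every odd prime factor of \<open>n\<close> divides \<open>(n choose 2)\<close>, and so does \<open>2\<close> when \<open>4\<close> divides \<open>n\<close>;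
  therefore \<open>b\<close> is coprime to \<open>n\<close> except possibly for the prime \<open>2\<close> when \<open>n \<equiv> 2 (mod 4)\<close>, that
  is, when \<open>n = 12 k + 2\<close>.

  There \<open>(n choose 2) - 1 = 18 k (4 k + 1)\<close> has \<open>2\<close>-adic valuation \<open>1 + \<nu>\<^sub>2(k)\<close>.  The remaining
  terms do not disturb this: \<open>(n choose j)\<close> inherits the factor \<open>n - 2 = 12 k\<close> up to the
  denominator \<open>j (j - 1) (j - 2)\<close>, whose powers of \<open>2\<close> are absorbed by those of \<open>n^(j - 2)\<close>
  (\<open>two_power_dvd_binomial_times_power\<close>), so they are all divisible by \<open>2^(2 + \<nu>\<^sub>2(k))\<close>.
\<close>

section \<open>The binomial expansion of the polynomials\<close>

definition binomial_sum :: "(nat \<Rightarrow> int) \<Rightarrow> int \<Rightarrow> nat \<Rightarrow> int" where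
  "binomial_sum s x n = (\<Sum>j\<le>n. int (n choose j) * x ^ j * s (n - j))"

text \<open>
  Symbolically this is \<open>(x + E)^n\<close> applied to \<open>s\<close> at \<open>0\<close>, where \<open>E\<close> is the shift operator;
  the step below splits off one factor \<open>x + E\<close> and is Pascal's rule.
\<close>

lemma binomial_sum_Suc:
  "binomial_sum s x (Suc n) = x * binomial_sum s x n + binomial_sum (\<lambda>k. s (Suc k)) x n"
proof -
  have "binomial_sum s x (Suc n) =
      s (Suc n) + (\<Sum>j\<le>n. int (Suc n choose Suc j) * x ^ Suc j * s (n - j))"
    unfolding binomial_sum_def by (subst sum.atMost_Suc_shift) simp
  also have "(\<Sum>j\<le>n. int (Suc n choose Suc j) * x ^ Suc j * s (n - j)) =
      x * binomial_sum s x n + (\<Sum>j\<le>n. int (n choose Suc j) * x ^ Suc j * s (n - j))"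
    by (simp add: binomial_sum_def sum_distrib_left sum.distrib[symmetric] algebra_simps)
  also have "s (Suc n) + (x * binomial_sum s x n +
        (\<Sum>j\<le>n. int (n choose Suc j) * x ^ Suc j * s (n - j))) =
      x * binomial_sum s x n + (\<Sum>j\<le>Suc n. int (n choose j) * x ^ j * s (Suc n - j))"
    by (subst sum.atMost_Suc_shift) simp
  also have "(\<Sum>j\<le>Suc n. int (n choose j) * x ^ j * s (Suc n - j)) =
      binomial_sum (\<lambda>k. s (Suc k)) x n"
    by (auto simp: binomial_sum_def Suc_diff_le intro!: sum.cong)
  finally show ?thesis .
qed

text \<open>
  This is \<open>(\<omega>^k - \<omega>^(2 k + 1)) / (1 - \<omega>)\<close>, the solution of \<open>s(k + 2) = - s(k + 1) - s(k)\<close> with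
  the initial values that match \<open>a\<^sub>0 = 1\<close> and \<open>a\<^sub>1 = x - 1\<close>.
\<close>

definition omega_seq :: "nat \<Rightarrow> int" where
  "omega_seq k = (if k mod 3 = 0 then 1 else if k mod 3 = 1 then -1 else 0)"

lemma omega_seq_mod_three:
  "omega_seq (3 * m) = 1" "omega_seq (3 * m + 1) = -1" "omega_seq (3 * m + 2) = 0"
  unfolding omega_seq_def by presburger+

lemma omega_seq_Suc_Suc: "omega_seq (Suc (Suc k)) = - omega_seq (Suc k) - omega_seq k"
proof -
  have "k mod 3 = 0 \<or> k mod 3 = 1 \<or> k mod 3 = 2" by linarith
  then show ?thesis
    by (auto simp: omega_seq_def mod_Suc)
qed

text \<open>
  Because \<open>E\<^sup>2 = - E - 1\<close> on \<open>omega_seq\<close>, the operator \<open>x + E\<close> satisfies the characteristic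
  equation of the recurrence that defines \<open>a_poly\<close>.
\<close>

lemma binomial_sum_omega_seq_Suc_Suc:
  "binomial_sum omega_seq x (Suc (Suc n)) =
     (2 * x - 1) * binomial_sum omega_seq x (Suc n)
     - (x\<^sup>2 - x + 1) * binomial_sum omega_seq x n"
proof -
  have "binomial_sum (\<lambda>k. omega_seq (Suc (Suc k))) x n =
      - binomial_sum (\<lambda>k. omega_seq (Suc k)) x n - binomial_sum omega_seq x n"
    unfolding binomial_sum_def omega_seq_Suc_Suc sum_negf[symmetric] sum_subtractf[symmetric]
    by (simp add: algebra_simps)
  then show ?thesis
    by (simp add: binomial_sum_Suc algebra_simps power2_eq_square)
qed

lemma poly_a_poly_eq_binomial_sum: "poly (a_poly n) x = binomial_sum omega_seq x n"
proof (induction n rule: a_poly.induct)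
  case (4 i)
  then show ?case
    using binomial_sum_omega_seq_Suc_Suc[of x "Suc i"]
    by (simp add: algebra_simps power2_eq_square)
qed (simp_all add: binomial_sum_def omega_seq_def algebra_simps)


section \<open>Powers of two in the higher terms\<close>

lemma coprime_two_power_odd:
  fixes a :: nat
  assumes "odd a"
  shows "coprime (2 ^ k) a"
  using assms by (simp add: coprime_power_left_iff)

text \<open>
  For odd \<open>j\<close> only the factor \<open>j - 1\<close> is even, and it is smaller than \<open>2^j\<close>.  For \<open>j = 2 i\<close> the
  product is \<open>4 i (i - 1) (2 i - 1)\<close>, where only one of \<open>i\<close>, \<open>i - 1\<close> is even, so \<open>2^(j - 2)\<close> would
  have to divide a positive number that is at most \<open>j / 2\<close>.
\<close>

lemma not_two_power_dvd_falling_three: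
  fixes j :: nat
  assumes "j \<ge> 4"
  shows "\<not> 2 ^ j dvd j * (j - 1) * (j - 2)"
proof
  assume dvd: "2 ^ j dvd j * (j - 1) * (j - 2)"
  show False
  proof (cases "even j")
    case False
    then have "coprime (2 ^ j) j" "coprime (2 ^ j) (j - 2)"
      using assms by (auto intro: coprime_two_power_odd)
    then have "2 ^ j dvd j - 1"
      using dvd by (simp add: coprime_dvd_mult_left_iff coprime_dvd_mult_right_iff)
    then have "2 ^ j \<le> j - 1"
      using assms by (intro dvd_imp_le) auto
    then show False
      using less_exp[of j] by linarith
  next
    case True
    then obtain i where j: "j = 2 * i" by (elim evenE)
    with assms have i: "i \<ge> 2" by simp
    \<comment> \<open>With \<open>i = l + 2\<close> the exponent \<open>j - 2\<close> is \<open>2 * l + 2\<close>, free of truncated subtraction.\<close>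
    define l where "l = i - 2"
    have l: "i = l + 2" using i by (simp add: l_def)
    have "2 ^ j = 4 * (2 ^ (2 * l + 2) :: nat)"
      by (simp add: j l power_add)
    moreover have "j * (j - 1) * (j - 2) = 4 * ((2 * i - 1) * (i * (i - 1)))"
      by (simp add: j l algebra_simps)
    ultimately have "4 * 2 ^ (2 * l + 2) dvd 4 * ((2 * i - 1) * (i * (i - 1)))"
      using dvd by (simp only:)
    then have "2 ^ (2 * l + 2) dvd (2 * i - 1) * (i * (i - 1))"
      by (rule nat_mult_dvd_cancel1[THEN iffD1, rotated]) simp
    moreover have "coprime (2 ^ (2 * l + 2)) (2 * i - 1)"
      using i by (intro coprime_two_power_odd) auto
    ultimately have dvd': "2 ^ (2 * l + 2) dvd i * (i - 1)"
      by (simp only: coprime_dvd_mult_right_iff)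
    have "2 ^ (2 * l + 2) dvd i \<or> 2 ^ (2 * l + 2) dvd i - 1"
    proof (cases "even i")
      case True
      then have "coprime (2 ^ (2 * l + 2)) (i - 1)"
        using i by (intro coprime_two_power_odd) auto
      with dvd' show ?thesis by (simp only: coprime_dvd_mult_left_iff simp_thms)
    next
      case False
      then have "coprime (2 ^ (2 * l + 2)) i"
        by (rule coprime_two_power_odd)
      with dvd' show ?thesis by (simp only: coprime_dvd_mult_right_iff simp_thms)
    qed
    then have "2 ^ (2 * l + 2) \<le> i"
      using i by (auto dest!: dvd_imp_le)
    moreover have "2 * l + 2 < (2::nat) ^ (2 * l + 2)"
      by (rule less_exp)
    ultimately show False using l by linarith
  qed
qed

lemma falling_three_times_binomial:
  assumes "j \<ge> 3"
  shows "j * (j - 1) * (j - 2) * (n choose j) =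
    n * (n - 1) * (n - 2) * ((n - 3) choose (j - 3))"
proof -
  define i where "i = j - 3"
  have j: "j = Suc (Suc (Suc i))" using assms by (simp add: i_def)
  have "j - 1 = Suc (Suc i)" "j - 2 = Suc i" using j by simp_all
  then have "j * (j - 1) * (j - 2) * (n choose j) =
      Suc i * (Suc (Suc i) * (Suc (Suc (Suc i)) * (n choose Suc (Suc (Suc i)))))"
    by (simp only: j ac_simps)
  also have "\<dots> = n * (Suc i * (Suc (Suc i) * ((n - 1) choose Suc (Suc i))))"
    by (simp only: binomial_absorption[of _ n] ac_simps)
  also have "\<dots> = n * ((n - 1) * (Suc i * ((n - 1 - 1) choose Suc i)))"
    by (simp only: binomial_absorption[of _ "n - 1"] ac_simps)
  also have "\<dots> = n * ((n - 1) * ((n - 1 - 1) * ((n - 1 - 1 - 1) choose i)))"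
    by (simp only: binomial_absorption)
  also have "\<dots> = n * (n - 1) * (n - 2) * ((n - 3) choose (j - 3))"
    by (simp add: i_def numeral_3_eq_3 numeral_2_eq_2)
  finally show ?thesis .
qed

text \<open>
  Multiplied by \<open>j (j - 1) (j - 2)\<close>, the number \<open>(n choose j) n^(j - 2)\<close> becomes a multiple of
  \<open>n^(j - 1) (n - 2)\<close>, hence of \<open>2^(j - 1 + r)\<close>; the multiplier contains at most \<open>j - 1\<close> factors \<open>2\<close>.
\<close>

lemma two_power_dvd_binomial_times_power:
  fixes n j r :: nat
  assumes "even n" and r: "2 ^ r dvd n - 2" and j: "j \<ge> 4"
  shows "2 ^ r dvd (n choose j) * n ^ (j - 2)"
proof -
  define f where "f = j * (j - 1) * (j - 2)"
  have "f \<noteq> 0" using j by (simp add: f_def)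
  define e where "e = multiplicity 2 f"
  obtain q where q: "f = 2 ^ e * q" and "\<not> 2 dvd q"
    unfolding e_def by (rule multiplicity_decompose'[of f 2]) (auto simp: \<open>f \<noteq> 0\<close>)
  have "\<not> j \<le> e"
    using not_two_power_dvd_falling_three[OF j] \<open>f \<noteq> 0\<close>
    by (simp add: e_def f_def power_dvd_iff_le_multiplicity)
  then have e: "e \<le> j - 1" by simp
  have "f * ((n choose j) * n ^ (j - 2)) =
      n * (n - 1) * (n - 2) * ((n - 3) choose (j - 3)) * n ^ (j - 2)"
    using falling_three_times_binomial[of j n] j by (simp add: f_def ac_simps)
  also have "\<dots> = n ^ Suc (j - 2) * (n - 2) * ((n - 1) * ((n - 3) choose (j - 3)))"
    by simp
  also have "Suc (j - 2) = j - 1" using j by simp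
  finally have eq: "f * ((n choose j) * n ^ (j - 2)) =
      n ^ (j - 1) * (n - 2) * ((n - 1) * ((n - 3) choose (j - 3)))" .
  have "2 ^ e dvd n ^ (j - 1)"
    using e \<open>even n\<close> by (meson dvd_power_same dvd_trans le_imp_power_dvd)
  then have "2 ^ e * 2 ^ r dvd f * ((n choose j) * n ^ (j - 2))"
    unfolding eq using r by (intro dvd_mult2 mult_dvd_mono)
  then have "2 ^ r dvd q * ((n choose j) * n ^ (j - 2))"
    unfolding q by (simp add: mult.assoc)
  moreover have "coprime (2 ^ r) q"
    using \<open>\<not> 2 dvd q\<close> by (rule coprime_two_power_odd)
  ultimately show ?thesis
    by (simp add: coprime_dvd_mult_right_iff)
qed


section \<open>The value at the index\<close>

text \<open>
  These are the terms \<open>j \<ge> 4\<close> of the expansion at \<open>x = n\<close>, divided by \<open>n\<^sup>2\<close>.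
\<close>

definition cofactor_tail :: "nat \<Rightarrow> int" where
  "cofactor_tail n = (\<Sum>j=4..n. int (n choose j) * int n ^ (j - 2) * omega_seq (n - j))"

lemma dvd_cofactor_tail: "int n dvd cofactor_tail n"
  unfolding cofactor_tail_def
  by (intro dvd_sum dvd_mult2 dvd_mult dvd_power) auto

lemma two_power_dvd_cofactor_tail:
  assumes "even n" and "2 ^ r dvd n - 2"
  shows "2 ^ r dvd cofactor_tail n"
  unfolding cofactor_tail_def
proof (rule dvd_sum, rule dvd_mult2)
  fix j assume "j \<in> {4..n}"
  then have "2 ^ r dvd (n choose j) * n ^ (j - 2)"
    using assms by (intro two_power_dvd_binomial_times_power) auto
  then have "int (2 ^ r) dvd int ((n choose j) * n ^ (j - 2))"
    by (simp only: int_dvd_int_iff)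
  then show "2 ^ r dvd int (n choose j) * int n ^ (j - 2)" by simp
qed

lemma poly_a_poly_self_mod:
  obtains t where "poly (a_poly n) (int n) = omega_seq n + int n * t"
proof -
  have "binomial_sum omega_seq (int n) n =
      omega_seq n + (\<Sum>j=1..n. int (n choose j) * int n ^ j * omega_seq (n - j))"
    unfolding binomial_sum_def by (simp add: atMost_atLeast0 sum.atLeast_Suc_atMost)
  moreover have "int n dvd (\<Sum>j=1..n. int (n choose j) * int n ^ j * omega_seq (n - j))"
    by (intro dvd_sum dvd_mult2 dvd_mult dvd_power) auto
  ultimately show ?thesis
    using that by (auto simp: poly_a_poly_eq_binomial_sum elim!: dvdE)
qed

lemma power_split_square:
  fixes x :: "'a::monoid_mult"
  assumes "j \<ge> 2"
  shows "x ^ j = x ^ 2 * x ^ (j - 2)"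
  using assms by (metis le_add_diff_inverse power_add)

lemma poly_a_poly_self_factor:
  assumes "n \<ge> 3" and "n mod 3 = 2"
  shows "poly (a_poly n) (int n) =
    int n ^ 2 * (int (n choose 2) - 1 + cofactor_tail n)"
proof -
  let ?g = "\<lambda>j. int (n choose j) * int n ^ j * omega_seq (n - j)"
  have vals: "omega_seq n = 0" "omega_seq (n - 1) = -1" "omega_seq (n - 2) = 1"
      "omega_seq (n - 3) = 0"
  proof -
    define m where "m = n div 3"
    have n: "n = 3 * m + 2" using assms(2) unfolding m_def by presburger
    with assms(1) have "m > 0" by (cases m) auto
    with n have "n - 1 = 3 * m + 1" "n - 2 = 3 * m" "n - 3 = 3 * (m - 1) + 2" by simp_all
    with n show "omega_seq n = 0" "omega_seq (n - 1) = -1" "omega_seq (n - 2) = 1"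
      "omega_seq (n - 3) = 0"
      by (simp_all only: omega_seq_mod_three)
  qed
  have "{..n} = {0, 1, 2, 3} \<union> {4..n}" using assms by auto
  then have "sum ?g {..n} = sum ?g {0, 1, 2, 3} + sum ?g {4..n}"
    by (simp only:) (rule sum.union_disjoint, auto)
  also have "sum ?g {0, 1, 2, 3} = int n ^ 2 * (int (n choose 2) - 1)"
    using vals by (simp add: algebra_simps power2_eq_square)
  also have "sum ?g {4..n} = int n ^ 2 * cofactor_tail n"
    unfolding cofactor_tail_def sum_distrib_left
  proof (rule sum.cong)
    fix j assume "j \<in> {4..n}"
    then have "int n ^ j = int n ^ 2 * int n ^ (j - 2)"
      by (intro power_split_square) simp
    then show "?g j = int n ^ 2 * (int (n choose j) * int n ^ (j - 2) * omega_seq (n - j))"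
      by (simp add: mult_ac)
  qed simp
  finally show ?thesis
    by (simp add: poly_a_poly_eq_binomial_sum binomial_sum_def algebra_simps)
qed


section \<open>The greatest common divisor\<close>

lemma gcd_self_power_poly_a_poly_eq_1:
  assumes "n mod 3 \<noteq> 2"
  shows "gcd (int n ^ n) (poly (a_poly n) (int n)) = 1"
proof -
  obtain t where t: "poly (a_poly n) (int n) = omega_seq n + int n * t"
    by (rule poly_a_poly_self_mod)
  have "omega_seq n = 1 \<or> omega_seq n = -1"
    using assms by (auto simp: omega_seq_def)
  then have "is_unit (omega_seq n)" by auto
  then have "coprime (int n) (omega_seq n + int n * t)"
    by (metis coprime_iff_gcd_eq_1 gcd_add_mult is_unit_right_imp_coprime add.commute mult.commute)
  then show ?thesis
    unfolding t by (simp add: coprime_power_left_iff)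
qed

lemma gcd_self_power_poly_a_poly_factor:
  assumes "n \<ge> 3" and "n mod 3 = 2"
  shows "gcd (int n ^ n) (poly (a_poly n) (int n)) =
    int n ^ 2 * gcd (int n ^ (n - 2)) (int (n choose 2) - 1 + cofactor_tail n)"
proof -
  have "int n ^ n = int n ^ 2 * int n ^ (n - 2)"
    using assms by (intro power_split_square) simp
  then show ?thesis
    unfolding poly_a_poly_self_factor[OF assms] by (simp flip: gcd_mult_distrib_int)
qed

text \<open>
  Under these hypotheses the cofactor is \<open>-1\<close> modulo \<open>m\<close>.
\<close>

lemma coprime_cofactor:
  assumes "m dvd n choose 2" and "m dvd n"
  shows "coprime (int m) (int (n choose 2) - 1 + cofactor_tail n)"
proof -
  have "int m dvd int (n choose 2) + cofactor_tail n"
    using assms dvd_cofactor_tail[of n] by (meson dvd_add dvd_trans int_dvd_int_iff)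
  then obtain t where "int (n choose 2) + cofactor_tail n = int m * t" by (elim dvdE)
  then have "int (n choose 2) - 1 + cofactor_tail n = -1 + int m * t" by simp
  then show ?thesis
    by (metis coprime_iff_gcd_eq_1 gcd_add_mult is_unit_right_imp_coprime add.commute
        mult.commute dvd_minus_iff one_dvd minus_dvd_iff)
qed

lemma binomial_two_double: "(2 * m) choose 2 = m * (2 * m - 1)"
  by (simp add: choose_two)

text \<open>
  For \<open>4\<close> dividing \<open>n\<close> it is enough to look at \<open>n / 2\<close>, which divides \<open>(n choose 2)\<close> and has the
  same prime factors as \<open>n\<close>.
\<close>

lemma coprime_cofactor_self:
  assumes "n mod 4 \<noteq> 2"
  shows "coprime (int n) (int (n choose 2) - 1 + cofactor_tail n)"
proof (cases "even n")
  case False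
  then obtain k where "n = 2 * k + 1" by (elim oddE)
  then have "n choose 2 = n * k" by (simp add: choose_two)
  then show ?thesis by (intro coprime_cofactor) auto
next
  case True
  with assms have "n mod 4 = 0" by presburger
  then obtain l where l: "n = 4 * l" by (auto elim!: dvdE simp: mod_eq_0_iff_dvd)
  have "coprime (int (2 * l)) (int (n choose 2) - 1 + cofactor_tail n)"
    using binomial_two_double[of "2 * l"] l by (intro coprime_cofactor) auto
  then have "coprime (int (2 * l) ^ 2) (int (n choose 2) - 1 + cofactor_tail n)"
    by (intro coprime_power_left_iff[THEN iffD2] disjI1)
  moreover have "int n dvd int (2 * l) ^ 2"
    by (simp add: l power2_eq_square)
  ultimately show ?thesis
    by (rule coprime_divisors[OF _ dvd_refl, rotated])
qed

text \<open>
  In the remaining case the odd number \<open>n / 2\<close> is coprime to the cofactor, and the power of \<open>2\<close> in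
  the cofactor is that of \<open>(n choose 2) - 1 = 18 k (4 k + 1)\<close>.
\<close>

lemma gcd_self_power_cofactor_two_mod_twelve:
  assumes n: "n = 12 * k + 2" and "k > 0"
  shows "gcd (int n ^ (n - 2)) (int (n choose 2) - 1 + cofactor_tail n) = 2 ^ (1 + nu2 k)"
proof -
  let ?b = "int (n choose 2) - 1 + cofactor_tail n"
  define v where "v = nu2 k"
  obtain k' where k': "k = 2 ^ v * k'" and "odd k'"
    using multiplicity_decompose'[of k 2] \<open>k > 0\<close> unfolding v_def by auto
  define m where "m = 6 * k + 1"
  have n2: "n = 2 * m" by (simp add: n m_def)
  have "2 ^ (v + 2) dvd n - 2"
  proof
    show "n - 2 = 2 ^ (v + 2) * (3 * k')" by (simp add: n k')
  qed
  then have "2 ^ (v + 2) dvd cofactor_tail n"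
    using n by (intro two_power_dvd_cofactor_tail) auto
  then obtain d where d: "cofactor_tail n = 2 ^ (v + 2) * d" by (elim dvdE)
  have "int (n choose 2) - 1 = 18 * int k * (4 * int k + 1)"
    unfolding n2 binomial_two_double by (simp add: m_def algebra_simps)
  then have b: "?b = 2 ^ (1 + v) * (9 * int k' * (4 * int k + 1) + 2 * d)"
    unfolding d k' by (simp add: algebra_simps)
  have odd: "odd (9 * int k' * (4 * int k + 1) + 2 * d)"
    using \<open>odd k'\<close> by simp
  have "coprime (int m) ?b"
    using binomial_two_double[of m] n2 by (intro coprime_cofactor) auto
  then have "coprime ?b (int m ^ (n - 2))"
    by (intro coprime_power_right_iff[THEN iffD2] disjI1) (simp only: coprime_commute)
  moreover have "int n ^ (n - 2) = 2 ^ (n - 2) * int m ^ (n - 2)"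
    unfolding power_mult_distrib[symmetric] by (simp add: n2)
  ultimately have "gcd (int n ^ (n - 2)) ?b = gcd (2 ^ (n - 2)) ?b"
    by (simp only: gcd_mult_left_right_cancel)
  \<comment> \<open>The power \<open>2^(n - 2)\<close> is large enough not to cut off the factor \<open>2^(1 + v)\<close> of the cofactor.\<close>
  also have "v < k"
  proof -
    have "v < 2 ^ v" by (rule less_exp)
    also have "2 ^ v \<le> k" using k' \<open>k > 0\<close> by (intro dvd_imp_le) auto
    finally show ?thesis .
  qed
  then have "(2::int) ^ (n - 2) = 2 ^ (1 + v) * 2 ^ (n - 2 - (1 + v))"
    by (simp only: power_add[symmetric]) (simp add: n)
  also have "gcd (2 ^ (1 + v) * 2 ^ (n - 2 - (1 + v))) ?b = 2 ^ (1 + v) *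
      gcd (2 ^ (n - 2 - (1 + v))) (9 * int k' * (4 * int k + 1) + 2 * d)"
    unfolding b by (simp only: gcd_mult_distrib_int[symmetric]) simp
  also have "gcd (2 ^ (n - 2 - (1 + v))) (9 * int k' * (4 * int k + 1) + 2 * d) = 1"
    unfolding coprime_iff_gcd_eq_1[symmetric] using odd
    by (intro coprime_power_left_iff[THEN iffD2] disjI1) simp
  finally show ?thesis by (simp add: v_def)
qed

theorem theorem2p21:
  fixes n :: nat
  assumes "n \<ge> 3"
  shows "gcd (int n ^ n) (poly (a_poly n) (int n)) =
    (if [n = 2] (mod 12) then 2 ^ (1 + nu2 (n div 12)) * int n ^ 2
     else if [n = 5] (mod 12) \<or> [n = 8] (mod 12) \<or> [n = 11] (mod 12) then int n ^ 2
     else 1)"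
proof (cases "n mod 3 = 2")
  case False
  then have "n mod 12 \<notin> {2, 5, 8, 11}" by (simp; presburger)
  then show ?thesis
    using gcd_self_power_poly_a_poly_eq_1[OF False] by (simp add: cong_def)
next
  case True
  note factor = gcd_self_power_poly_a_poly_factor[OF assms True]
  show ?thesis
  proof (cases "n mod 12 = 2")
    case m2: True
    define k where "k = n div 12"
    have n: "n = 12 * k + 2" using m2 unfolding k_def by presburger
    then have "k > 0" using assms by (cases k) auto
    then show ?thesis
      using factor gcd_self_power_cofactor_two_mod_twelve[OF n] m2
      by (simp add: cong_def k_def)
  next
    case False
    then have "n mod 4 \<noteq> 2" using True by presburger
    then have "coprime (int n ^ (n - 2)) (int (n choose 2) - 1 + cofactor_tail n)"
      by (intro coprime_power_left_iff[THEN iffD2] disjI1 coprime_cofactor_self)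
    moreover have "n mod 12 = 5 \<or> n mod 12 = 8 \<or> n mod 12 = 11"
      using True False by presburger
    ultimately show ?thesis
      using factor False by (simp add: cong_def)
  qed
qed

end
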